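(* Let $\sigma = 2\sqrt{2}\,\pi$ and, for a positive integer $N_1$, let $p_j = -\exp\!\big(-\sigma(\sqrt{N_1}-\sqrt{j}\,)\big)$, $1\le j\le N_1$. Assume the following bound holds for all sufficiently large positive integers $N_t$, with $h=2\pi^2$ and $T=\sqrt{N_t h/4}$: for every $x\in[e^{4-2T},1]$, $$\left|\int_\Gamma f(u,x)\,\delta(u)\,du\right| < 12\, e^{-T},$$ with $f,\delta,\Gamma$ as in the context. Then there exist coefficients $a_1,\dots,a_{N_1}$ and a polynomial $b$ of degree $N_2=\mathcal{O}(\sqrt{N_1}\,)$ such that, with $N=N_1+N_2$, the rational function $r(x)=\sum_{j=1}^{N_1}\frac{a_j}{x-p_j}+b(x)$ satisfies $$|r(x)-\sqrt{x}\,| = \mathcal{O}\big(e^{-\pi\sqrt{2N}}\big)$$ as $N\to\infty$, uniformly for $x\in[0,1]$.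
   Context: Here $\sqrt{u}$ denotes the principal branch of the square root. For $u\in\mathbb{C}$ and $x\in(0,1]$, $f(u,x) = \frac{x}{\pi}\,\frac{1}{\sqrt{u}}\,\frac{e^{\sqrt{u}-T}}{e^{2(\sqrt{u}-T)}+x}$. The function $\delta(u)=\mu(u)-m(u)$, where $\mu(u)=-\tfrac12$ if $\operatorname{Im}u\ge 0$ and $\mu(u)=\tfrac12$ if $\operatorname{Im}u<0$, and $m(u) = -\tfrac{i}{2}\cot(\pi u/h)$. The contour $\Gamma$ is the positively oriented boundary of the rectangle $\{u: 1\le \operatorname{Re}u\le 4T^2+1,\ |\operatorname{Im}u|\le a\}$ with $a = 2\pi(T+\tfrac12\log x)$. *)

theory Defs
  imports "HOL-Complex_Analysis.Complex_Analysis" "HOL-Computational_Algebra.Polynomial"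
begin

definition f_int :: "real \<Rightarrow> complex \<Rightarrow> real \<Rightarrow> complex" where
  "f_int T u x = (of_real x / of_real pi) * (1 / csqrt u) *
      (exp (csqrt u - of_real T) / (exp (2 * (csqrt u - of_real T)) + of_real x))"

definition mu_fn :: "complex \<Rightarrow> complex" where
  "mu_fn u = (if Im u \<ge> 0 then - 1/2 else 1/2)"

definition m_fn :: "real \<Rightarrow> complex \<Rightarrow> complex" where
  "m_fn h u = - (\<i> / 2) * cot (of_real pi * u / of_real h)"

definition delta_fn :: "real \<Rightarrow> complex \<Rightarrow> complex" where
  "delta_fn h u = mu_fn u - m_fn h u"

definition Gamma_path :: "real \<Rightarrow> real \<Rightarrow> real \<Rightarrow> complex" where
  "Gamma_path T x =
     (let a = 2 * pi * (T + ln x / 2); R = 4 * T^2 + 1 in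
        linepath (Complex 1 (-a)) (Complex R (-a)) +++
        linepath (Complex R (-a)) (Complex R a) +++
        linepath (Complex R a) (Complex 1 a) +++
        linepath (Complex 1 a) (Complex 1 (-a)))"

definition sigma_c :: real where "sigma_c = 2 * sqrt 2 * pi"

definition pole :: "nat \<Rightarrow> nat \<Rightarrow> real" where
  "pole N1 j = - exp (- sigma_c * (sqrt (real N1) - sqrt (real j)))"

definition rat_approx :: "(nat \<Rightarrow> real) \<Rightarrow> real poly \<Rightarrow> nat \<Rightarrow> real \<Rightarrow> real" where
  "rat_approx a b N1 x = (\<Sum>j=1..N1. a j / (x - pole N1 j)) + poly b x"

end

theory Submission
  imports Defs
begin

text \<open>
  Substituting \<open>t = \<surd>u - T\<close> turns \<open>\<surd>x = (2 x / \<pi>) \<integral> e\<^sup>t / (e\<^sup>2\<^sup>t + x) dt\<close> into an integral of \<open>f(u, x)\<close>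
  over \<open>u\<close>, and the trapezoidal rule with step \<open>h\<close> and \<open>N\<^sub>t = 4 N\<^sub>1\<close> nodes is a rational function of \<open>x\<close>
  whose \<open>j\<close>-th pole is \<open>p\<^sub>j\<close>. By the residue theorem the contour integral of \<open>f \<delta>\<close> over \<open>\<Gamma>\<close> is
  the trapezoidal error, up to truncation of the integral and the contributions of the two poles of
  \<open>f\<close> inside \<open>\<Gamma>\<close>. These poles are \<open>(T + ln x / 2 \<plusminus> i \<pi> / 2)\<^sup>2\<close>; the residues have modulus
  \<open>\<surd>x / \<pi>\<close> and \<open>\<delta>\<close> is \<open>O(e\<^sup>-\<^sup>T / \<surd>x)\<close> there, so all errors are \<open>O(e\<^sup>-\<^sup>T)\<close> with \<open>T = \<pi> \<surd>(2 N\<^sub>1)\<close>.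
  For \<open>x < e\<^bsup>4 - 2T\<^esup>\<close> both \<open>\<surd>x\<close> and the trapezoidal sum are themselves \<open>O(e\<^sup>-\<^sup>T)\<close>.
  The terms with \<open>j > N\<^sub>1\<close> have poles in \<open>(-\<infinity>, -1)\<close>, so their sum is
  approximated on \<open>[0, 1]\<close> within \<open>O(e\<^sup>-\<^sup>T)\<close> by a polynomial of degree \<open>O(T)\<close>; since
  \<open>N\<^sub>2 = O(\<surd>N\<^sub>1)\<close>, replacing \<open>N\<^sub>1\<close> by \<open>N\<close> in the exponent costs only a constant factor.
\<close>

section \<open>Residues and contour integrals over rectangles\<close>

lemma convex_open_between_compact_and_open:
  fixes K :: "'a::{real_normed_vector, heine_borel} set"
  assumes "compact K" "convex K" "open U" "K \<subseteq> U"
  obtains V where "open V" "convex V" "K \<subseteq> V" "V \<subseteq> U"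
proof -
  obtain e where e: "0 < e" "(\<Union>x\<in>K. ball x e) \<subseteq> U"
    using compact_subset_open_imp_ball_epsilon_subset assms by blast
  have "(\<Union>x\<in>K. ball x e) = (\<Union>x\<in>K. \<Union>y\<in>ball 0 e. {x + y})"
  proof (intro SUP_cong refl)
    fix x :: 'a
    show "ball x e = (\<Union>y\<in>ball 0 e. {x + y})"
      by (auto simp: dist_norm norm_minus_commute intro: bexI[of _ "_ - x"])
  qed
  then have "open (\<Union>x\<in>K. ball x e)" "convex (\<Union>x\<in>K. ball x e)"
    using convex_sums[OF \<open>convex K\<close> convex_ball, of 0 e] open_sums[of K "ball 0 e"] by simp_all
  moreover have "K \<subseteq> (\<Union>x\<in>K. ball x e)" using e(1) by auto
  ultimately show thesis using that e(2) by blast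
qed

lemma contour_integrable_on_rectpath:
  assumes "Re a \<le> Re b" "Im a \<le> Im b" "f analytic_on cbox a b - pts" "pts \<subseteq> box a b"
  shows "f contour_integrable_on rectpath a b"
  using assms path_image_rectpath_cbox_minus_box[of a b]
  by (intro analytic_imp_contour_integrable analytic_on_subset[OF assms(3)]) auto

lemma Residue_theorem_rectpath:
  assumes ab: "Re a < Re b" "Im a < Im b"
      and f: "f analytic_on cbox a b - pts" and pts: "finite pts" "pts \<subseteq> box a b"
  shows "contour_integral (rectpath a b) f = 2 * pi * \<i> * (\<Sum>p\<in>pts. residue f p)"
proof -
  obtain W where W: "open W" "cbox a b - pts \<subseteq> W" "f holomorphic_on W"
    using f unfolding analytic_on_holomorphic by blast
  have "cbox a b \<subseteq> W \<union> box a b" using W(2) pts(2) by blast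
  then obtain V where V: "open V" "convex V" "cbox a b \<subseteq> V" "V \<subseteq> W \<union> box a b"
    using convex_open_between_compact_and_open[of "cbox a b" "W \<union> box a b"] W(1)
    by (metis compact_cbox convex_box(1) open_Un open_box)
  have "contour_integral (rectpath a b) f
      = 2 * pi * \<i> * (\<Sum>p\<in>pts. winding_number (rectpath a b) p * residue f p)"
  proof (rule Residue_theorem)
    have "V - pts \<subseteq> W" using V(4) W(2) box_subset_cbox[of a b] by blast
    then show "f holomorphic_on V - pts" by (rule holomorphic_on_subset[OF W(3)])
    show "path_image (rectpath a b) \<subseteq> V - pts"
      using ab V(3) pts(2) path_image_rectpath_cbox_minus_box[of a b] by auto
    show "\<forall>z. z \<notin> V \<longrightarrow> winding_number (rectpath a b) z = 0"
      using ab V(3) by (auto intro!: winding_number_rectpath_outside)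
  qed (use V pts convex_connected in auto)
  also have "(\<Sum>p\<in>pts. winding_number (rectpath a b) p * residue f p) = (\<Sum>p\<in>pts. residue f p)"
    using pts(2) by (intro sum.cong) (auto simp: winding_number_rectpath subset_iff)
  finally show ?thesis .
qed

lemma residue_simple_zero_denominator:
  assumes f: "f analytic_on {z}" and g: "g analytic_on {z}"
      and "g z = 0" "(g has_field_derivative g') (at z)" "g' \<noteq> 0"
  shows "residue (\<lambda>w. f w / g w) z = f z / g'"
proof -
  have "isolated_zero g z"
  proof (rule ccontr)
    assume "\<not> isolated_zero g z"
    then have "eventually (\<lambda>w. g w = 0) (nhds z)"
      using non_isolated_zero_imp_eventually_zero' assms by blast
    then have "(g has_field_derivative g') (at z) \<longleftrightarrow> ((\<lambda>_. 0) has_field_derivative g') (at z)"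
      by (intro DERIV_cong_ev) auto
    with assms show False using DERIV_const DERIV_unique by blast
  qed
  then have "eventually (\<lambda>w. g w \<noteq> 0) (at z)" by (simp add: isolated_zero_def)
  then obtain A where A: "open A" "z \<in> A" "\<And>w. w \<in> A - {z} \<Longrightarrow> g w \<noteq> 0"
    unfolding eventually_at_topological by auto
  obtain B where B: "open B" "z \<in> B" "f holomorphic_on B" "g holomorphic_on B"
    using f g analytic_at_two by blast
  show ?thesis
  proof (rule residue_simple')
    show "(\<lambda>w. f w / g w) holomorphic_on A \<inter> B - {z}"
      using A(3) by (intro holomorphic_intros holomorphic_on_subset[OF B(3)] holomorphic_on_subset[OF B(4)]) auto
    have "(f has_field_derivative deriv f z) (at z)"
      using B by (intro holomorphic_derivI)
    then have "((\<lambda>w. f w * (w - z)) has_field_derivative f z) (at z)"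
      by (auto intro!: derivative_eq_intros)
    then have "((\<lambda>w. f w * (w - z) / g w) \<longlongrightarrow> f z / g') (at z)"
      using assms by (intro lhopital_complex_simple) auto
    then show "((\<lambda>w. f w / g w * (w - z)) \<longlongrightarrow> f z / g') (at z)"
      by (simp add: field_split_simps)
  qed (use A B in auto)
qed

lemma has_contour_integral_linepath_cong:
  assumes "(f has_contour_integral i) (linepath a b)"
      and eq: "\<And>z. z \<in> open_segment a b \<Longrightarrow> f z = g z"
  shows "(g has_contour_integral i) (linepath a b)"
  unfolding has_contour_integral_linepath
proof (rule has_integral_spike_finite)
  show "((\<lambda>t. f (linepath a b t) * (b - a)) has_integral i) {0..1}"
    using assms(1) by (simp add: has_contour_integral_linepath)
  show "finite {0, 1::real}" by simp
  show "g (linepath a b t) * (b - a) = f (linepath a b t) * (b - a)" if "t \<in> {0..1} - {0, 1}" for t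
  proof (cases "a = b")
    case False
    then have "linepath a b t \<in> open_segment a b"
      using that by (auto simp: linepath_def in_segment intro!: exI[of _ t])
    then show ?thesis using eq by simp
  qed simp
qed

lemma has_contour_integral_linepath_split_at_Im:
  assumes st: "s < t" and tr: "t < r"
      and g: "(g has_contour_integral i) (linepath (Complex c s) (Complex c t))"
      and k: "(k has_contour_integral j) (linepath (Complex c t) (Complex c r))"
      and below: "\<And>u. Im u < t \<Longrightarrow> g u = f u" and above: "\<And>u. t < Im u \<Longrightarrow> k u = f u"
  shows "(f has_contour_integral i + j) (linepath (Complex c s) (Complex c r))"
proof (rule has_contour_integral_split)
  have Im: "p < Im z" "Im z < q" if "z \<in> open_segment (Complex c p) (Complex c q)" "p < q" for p q z
  proof -
    have "Re z = c" "p \<le> Im z" "Im z \<le> q" "z \<noteq> Complex c p" "z \<noteq> Complex c q"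
      using that by (auto simp: open_segment_def closed_segment_same_Re closed_segment_eq_real_ivl)
    then show "p < Im z" "Im z < q" by (auto simp: complex_eq_iff)
  qed
  show "(f has_contour_integral i) (linepath (Complex c s) (Complex c t))"
    by (rule has_contour_integral_linepath_cong[OF g]) (use below Im(2) st in blast)
  show "(f has_contour_integral j) (linepath (Complex c t) (Complex c r))"
    by (rule has_contour_integral_linepath_cong[OF k]) (use above Im(1) tr in blast)
  show "Complex c t - Complex c s = ((t - s) / (r - s)) *\<^sub>R (Complex c r - Complex c s)"
    using st tr by (simp add: complex_eq_iff)
qed (use st tr in auto)

lemma contour_integrable_on_edges_of_rectpath:
  assumes "f contour_integrable_on rectpath (Complex c s) (Complex d t)"
  shows "f contour_integrable_on linepath (Complex c s) (Complex d s)"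
        "f contour_integrable_on linepath (Complex d s) (Complex d t)"
        "f contour_integrable_on linepath (Complex c t) (Complex d t)"
        "f contour_integrable_on linepath (Complex c s) (Complex c t)"
proof -
  have "f contour_integrable_on linepath q p" if "f contour_integrable_on linepath p q" for p q
    using contour_integrable_reversepath[OF _ that] by simp
  from this[of "Complex d t" "Complex c t"] this[of "Complex c t" "Complex c s"] assms
  show "f contour_integrable_on linepath (Complex c s) (Complex d s)"
       "f contour_integrable_on linepath (Complex d s) (Complex d t)"
       "f contour_integrable_on linepath (Complex c t) (Complex d t)"
       "f contour_integrable_on linepath (Complex c s) (Complex c t)"
    by (simp_all add: rectpath_def Let_def)
qed

lemma has_contour_integral_rectpath:
  assumes bottom: "(f has_contour_integral B) (linepath (Complex c s) (Complex d s))"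
      and right: "(f has_contour_integral R) (linepath (Complex d s) (Complex d t))"
      and top: "(f has_contour_integral T) (linepath (Complex c t) (Complex d t))"
      and left: "(f has_contour_integral L) (linepath (Complex c s) (Complex c t))"
  shows "(f has_contour_integral B + R - T - L) (rectpath (Complex c s) (Complex d t))"
proof -
  have "(f has_contour_integral - T) (linepath (Complex d t) (Complex c t))"
       "(f has_contour_integral - L) (linepath (Complex c t) (Complex c s))"
    using has_contour_integral_reversepath[OF _ top] has_contour_integral_reversepath[OF _ left] by simp_all
  then have "(f has_contour_integral B + (R + (- T + - L))) (rectpath (Complex c s) (Complex d t))"
    unfolding rectpath_def Let_def complex.sel
    by (intro has_contour_integral_join bottom right valid_path_join valid_path_linepath) auto
  then show ?thesis by (simp add: algebra_simps)
qed

lemma has_contour_integral_rectpath_split_at_Im: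
  assumes st: "s < t" and tr: "t < r"
      and g: "g contour_integrable_on rectpath (Complex c s) (Complex d t)"
      and k: "k contour_integrable_on rectpath (Complex c t) (Complex d r)"
      and below: "\<And>u. Im u < t \<Longrightarrow> g u = f u" and above: "\<And>u. t < Im u \<Longrightarrow> k u = f u"
  shows "(f has_contour_integral
            contour_integral (rectpath (Complex c s) (Complex d t)) g
            + contour_integral (rectpath (Complex c t) (Complex d r)) k
            + contour_integral (linepath (Complex c t) (Complex d t)) (\<lambda>u. g u - k u))
          (rectpath (Complex c s) (Complex d r))"
proof -
  note g_edges = contour_integrable_on_edges_of_rectpath[OF g, THEN has_contour_integral_integral]
  note k_edges = contour_integrable_on_edges_of_rectpath[OF k, THEN has_contour_integral_integral]
  have bottom: "(f has_contour_integral contour_integral (linepath (Complex c s) (Complex d s)) g)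
      (linepath (Complex c s) (Complex d s))"
    by (rule has_contour_integral_eq[OF g_edges(1)])
       (use st in \<open>auto simp: closed_segment_same_Im intro: below\<close>)
  have top: "(f has_contour_integral contour_integral (linepath (Complex c r) (Complex d r)) k)
      (linepath (Complex c r) (Complex d r))"
    by (rule has_contour_integral_eq[OF k_edges(3)])
       (use tr in \<open>auto simp: closed_segment_same_Im intro: above\<close>)
  note right = has_contour_integral_linepath_split_at_Im[OF st tr g_edges(2) k_edges(2) below above]
  note left = has_contour_integral_linepath_split_at_Im[OF st tr g_edges(4) k_edges(4) below above]
  show ?thesis
    using has_contour_integral_rectpath[OF bottom right top left]
    unfolding has_contour_integral_rectpath[OF g_edges, THEN contour_integral_unique]
      has_contour_integral_rectpath[OF k_edges, THEN contour_integral_unique]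
      has_contour_integral_diff[OF g_edges(3) k_edges(1), THEN contour_integral_unique]
    by (simp add: algebra_simps)
qed

section \<open>The trapezoidal rule as a contour integral\<close>

definition grid :: "real \<Rightarrow> complex set" where
  "grid h = range (\<lambda>k::int. of_real (of_int k * h))"

lemma grid_subset_Reals: "grid h \<subseteq> \<real>"
  by (auto simp: grid_def)

lemma sin_pi_times_over_eq_0_iff:
  assumes "h \<noteq> 0"
  shows "sin (of_real pi * u / of_real h) = 0 \<longleftrightarrow> u \<in> grid h"
proof -
  have "of_real pi * u / of_real h = of_real (of_int k * pi) \<longleftrightarrow> u = of_real (of_int k * h)" for k :: int
    using assms by (auto simp: field_simps)
  then show ?thesis by (auto simp only: sin_eq_0 grid_def image_iff UNIV_I)
qed

lemma finite_grid_Int_bounded: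
  assumes "h \<noteq> 0" "bounded S"
  shows "finite (grid h \<inter> S)"
proof -
  obtain B where B: "\<And>u. u \<in> S \<Longrightarrow> norm u \<le> B"
    using assms(2) unfolding bounded_iff by blast
  have "grid h \<inter> S \<subseteq> (\<lambda>k. of_real (k * h)) ` {k \<in> \<int>. \<bar>k\<bar> \<le> B / \<bar>h\<bar>}"
  proof
    fix u assume "u \<in> grid h \<inter> S"
    then obtain k :: int where k: "u = of_real (of_int k * h)" "norm u \<le> B"
      using B by (auto simp: grid_def)
    then have "\<bar>of_int k\<bar> * \<bar>h\<bar> \<le> B" by (simp only: norm_of_real abs_mult)
    then show "u \<in> (\<lambda>k. of_real (k * h)) ` {k \<in> \<int>. \<bar>k\<bar> \<le> B / \<bar>h\<bar>}"
      unfolding k(1) using assms(1) by (intro imageI) (simp add: field_simps)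
  qed
  then show ?thesis by (rule finite_subset) (intro finite_imageI finite_abs_int_segment)
qed

lemma m_fn_analytic_on:
  assumes "h \<noteq> 0" "S \<inter> grid h = {}"
  shows "m_fn h analytic_on S"
proof -
  have "(\<lambda>u. - (\<i> / 2) * (cos (of_real pi * u / of_real h) / sin (of_real pi * u / of_real h))) analytic_on S"
    using assms by (intro analytic_intros) (auto simp: sin_pi_times_over_eq_0_iff)
  then show ?thesis by (simp add: m_fn_def [abs_def] cot_def)
qed

lemma eventually_mu_fn_eq:
  assumes "Im z \<noteq> 0"
  shows "\<forall>\<^sub>F u in nhds z. mu_fn u = mu_fn z"
proof -
  have "\<forall>\<^sub>F u in nhds z. 0 < Im u * Im z"
    by (rule order_tendstoD(1)[of _ "Im z * Im z"])
       (use assms in \<open>auto intro!: tendsto_intros filterlim_ident simp: zero_less_mult_iff\<close>)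
  then show ?thesis
    by (rule eventually_mono) (auto simp: mu_fn_def zero_less_mult_iff)
qed

lemma mu_fn_analytic_on:
  assumes "S \<inter> \<real> = {}"
  shows "mu_fn analytic_on S"
proof (subst analytic_on_analytic_at, rule ballI)
  fix z assume "z \<in> S"
  then have "\<forall>\<^sub>F u in nhds z. mu_fn u = mu_fn z"
    using assms by (intro eventually_mu_fn_eq) (auto simp: complex_is_Real_iff)
  then show "mu_fn analytic_on {z}" by (subst analytic_at_cong) auto
qed

lemma delta_fn_analytic_on:
  assumes "h \<noteq> 0" "S \<inter> \<real> = {}"
  shows "delta_fn h analytic_on S"
  unfolding delta_fn_def [abs_def]
  using assms grid_subset_Reals
  by (intro analytic_intros mu_fn_analytic_on m_fn_analytic_on) blast+

lemma cot_exp_eq: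
  assumes "exp (2 * \<i> * z) \<noteq> (1::complex)"
  shows "cot z = \<i> * ((exp (2 * \<i> * z) + 1) / (exp (2 * \<i> * z) - 1))"
proof -
  define w where "w = exp (\<i> * z)"
  have w: "exp (2 * \<i> * z) = w\<^sup>2" "exp (- (\<i> * z)) = inverse w" "w \<noteq> 0"
    unfolding w_def using exp_double[of "\<i> * z"] by (simp_all add: mult.assoc exp_minus)
  have "w\<^sup>2 - 1 \<noteq> 0" using assms w(1) by simp
  then show ?thesis
    unfolding w(1) cot_def sin_exp_eq cos_exp_eq w(2) w_def [symmetric] using w(3)
    by (simp add: field_simps power2_eq_square)
qed

lemma norm_delta_fn_le:
  assumes "0 < h" "Im u \<noteq> 0"
  shows "norm (delta_fn h u) \<le> 1 / (exp (2 * pi * \<bar>Im u\<bar> / h) - 1)"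
proof -
  define w where "w = exp (2 * \<i> * (of_real pi * u / of_real h))"
  have norm_w: "norm w = exp (- (2 * pi * Im u / h))"
    by (simp add: w_def)
  have w0: "w \<noteq> 0" by (simp add: w_def)
  have w1: "w \<noteq> 1" using norm_w assms by auto
  have m: "m_fn h u = (w + 1) / (w - 1) / 2"
  proof -
    have "- (\<i> / 2) * (\<i> * X) = X / 2" for X by simp
    then show ?thesis
      by (simp only: m_fn_def cot_exp_eq[OF w1[unfolded w_def], folded w_def])
  qed
  obtain v :: complex where v: "norm v = exp (2 * pi * \<bar>Im u\<bar> / h)" "norm (delta_fn h u) = 1 / norm (v - 1)"
  proof (cases "0 < Im u")
    case True
    have "delta_fn h u = 1 / (inverse w - 1)"
      unfolding delta_fn_def m using True w0 w1 by (simp add: mu_fn_def field_simps)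
    moreover have "norm (inverse w) = exp (2 * pi * \<bar>Im u\<bar> / h)"
      using True by (simp add: norm_inverse norm_w exp_minus)
    ultimately show thesis using that[of "inverse w"] by (simp add: norm_divide)
  next
    case False
    then have "delta_fn h u = - (1 / (w - 1))"
      unfolding delta_fn_def m using assms(2) w0 w1 by (simp add: mu_fn_def field_simps)
    moreover have "norm w = exp (2 * pi * \<bar>Im u\<bar> / h)"
      using False by (simp add: norm_w)
    ultimately show thesis using that[of w] by (simp add: norm_divide)
  qed
  have "1 < norm v" using assms by (simp add: v(1))
  then show ?thesis
    unfolding v(2) v(1) [symmetric] using norm_triangle_ineq2[of v 1]
    by (intro divide_left_mono mult_pos_pos) auto
qed

lemma residue_times_m_fn_at_grid:
  assumes h: "h \<noteq> 0" and z: "z \<in> grid h" and f: "f analytic_on {z}"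
  shows "residue (\<lambda>u. f u * m_fn h u) z = - (\<i> * of_real h / (2 * of_real pi)) * f z"
proof -
  define c where "c = (\<lambda>u. cos (of_real pi * u / of_real h :: complex))"
  have sin0: "sin (of_real pi * z / of_real h) = 0"
    using sin_pi_times_over_eq_0_iff h z by blast
  then have cz: "c z \<noteq> 0"
    using sin_cos_squared_add[of "of_real pi * z / of_real h"] by (auto simp: c_def)
  have "residue (\<lambda>u. (f u * (- (\<i> / 2) * c u)) / sin (of_real pi * u / of_real h)) z
      = (f z * (- (\<i> / 2) * c z)) / (c z * (of_real pi / of_real h))"
  proof (rule residue_simple_zero_denominator)
    show "(\<lambda>u. f u * (- (\<i> / 2) * c u)) analytic_on {z}"
      unfolding c_def using h f by (intro analytic_intros) auto
    show "(\<lambda>u. sin (of_real pi * u / of_real h)) analytic_on {z}"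
      using h by (intro analytic_intros) auto
    show "((\<lambda>u. sin (of_real pi * u / of_real h)) has_field_derivative c z * (of_real pi / of_real h)) (at z)"
      unfolding c_def using h by (auto intro!: derivative_eq_intros)
  qed (use sin0 cz h in auto)
  moreover have "(\<lambda>u. (f u * (- (\<i> / 2) * c u)) / sin (of_real pi * u / of_real h)) = (\<lambda>u. f u * m_fn h u)"
    by (simp add: fun_eq_iff c_def m_fn_def cot_def)
  ultimately show ?thesis using cz h by (simp add: field_simps)
qed

lemma sum_mu_fn_times:
  assumes "finite P"
  shows "(\<Sum>p\<in>P. mu_fn p * g p) = (\<Sum>p\<in>{p \<in> P. Im p < 0}. g p) / 2 - (\<Sum>p\<in>{p \<in> P. 0 \<le> Im p}. g p) / 2"
proof -
  have "P = {p \<in> P. Im p < 0} \<union> {p \<in> P. 0 \<le> Im p}" by auto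
  then have "(\<Sum>p\<in>P. mu_fn p * g p)
      = (\<Sum>p\<in>{p \<in> P. Im p < 0}. mu_fn p * g p) + (\<Sum>p\<in>{p \<in> P. 0 \<le> Im p}. mu_fn p * g p)"
    using assms by (subst sum.union_disjoint [symmetric]) auto
  also have "\<dots> = (\<Sum>p\<in>{p \<in> P. Im p < 0}. g p / 2) + (\<Sum>p\<in>{p \<in> P. 0 \<le> Im p}. - (g p / 2))"
    by (intro arg_cong2[where f = "(+)"] sum.cong) (auto simp: mu_fn_def)
  finally show ?thesis by (simp add: sum_divide_distrib sum_negf)
qed

lemma has_contour_integral_rectpath_times_mu_fn:
  assumes cd: "c < d" and a: "0 < a"
      and P: "finite P" "P \<subseteq> box (Complex c (-a)) (Complex d a)" "P \<inter> \<real> = {}"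
      and f: "f analytic_on cbox (Complex c (-a)) (Complex d a) - P"
  shows "((\<lambda>u. f u * mu_fn u) has_contour_integral
            contour_integral (linepath (Complex c 0) (Complex d 0)) f
            + 2 * pi * \<i> * (\<Sum>p\<in>P. mu_fn p * residue f p))
          (rectpath (Complex c (-a)) (Complex d a))"
proof -
  define L where "L = {p \<in> P. Im p < 0}"
  define U where "U = {p \<in> P. 0 \<le> Im p}"
  have finite: "finite L" "finite U" using P(1) by (auto simp: L_def U_def)
  have U_pos: "0 < Im p" if "p \<in> U" for p
    using that P(3) complex_is_Real_iff[of p] by (force simp: U_def)
  have nonpos_in_L: "p \<in> L" if "p \<in> P" "Im p \<le> 0" for p
    using that P(3) complex_is_Real_iff[of p] by (force simp: L_def)
  have fL: "f analytic_on cbox (Complex c (-a)) (Complex d 0) - L"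
    using a nonpos_in_L by (auto intro!: analytic_on_subset[OF f] simp: in_cbox_complex_iff)
  have fU: "f analytic_on cbox (Complex c 0) (Complex d a) - U"
    using a by (auto intro!: analytic_on_subset[OF f] simp: in_cbox_complex_iff U_def)
  have L: "L \<subseteq> box (Complex c (-a)) (Complex d 0)" and U: "U \<subseteq> box (Complex c 0) (Complex d a)"
    using P(2) U_pos by (auto simp: in_box_complex_iff L_def U_def)
  have lower: "contour_integral (rectpath (Complex c (-a)) (Complex d 0)) f = 2 * pi * \<i> * (\<Sum>p\<in>L. residue f p)"
    using Residue_theorem_rectpath[OF _ _ fL finite(1) L] cd a by simp
  have upper: "contour_integral (rectpath (Complex c 0) (Complex d a)) f = 2 * pi * \<i> * (\<Sum>p\<in>U. residue f p)"
    using Residue_theorem_rectpath[OF _ _ fU finite(2) U] cd a by simp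
  have int_lower: "f contour_integrable_on rectpath (Complex c (-a)) (Complex d 0)"
    by (rule contour_integrable_on_rectpath[OF _ _ fL L]) (use cd a in auto)
  have int_upper: "f contour_integrable_on rectpath (Complex c 0) (Complex d a)"
    by (rule contour_integrable_on_rectpath[OF _ _ fU U]) (use cd a in auto)
  have "((\<lambda>u. f u * mu_fn u) has_contour_integral
      contour_integral (rectpath (Complex c (-a)) (Complex d 0)) (\<lambda>u. f u * (1/2))
      + contour_integral (rectpath (Complex c 0) (Complex d a)) (\<lambda>u. f u * (- 1/2))
      + contour_integral (linepath (Complex c 0) (Complex d 0)) (\<lambda>u. f u * (1/2) - f u * (- 1/2)))
      (rectpath (Complex c (-a)) (Complex d a))"
    using a by (intro has_contour_integral_rectpath_split_at_Im contour_integrable_rmul int_lower int_upper)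
       (auto simp: mu_fn_def)
  moreover have "(\<lambda>u. f u * (1/2) - f u * (- 1/2)) = f" by (simp add: fun_eq_iff)
  ultimately show ?thesis
    unfolding contour_integral_rmul[OF int_lower] contour_integral_rmul[OF int_upper] lower upper sum_mu_fn_times[OF P(1)]
      L_def [symmetric] U_def [symmetric]
    by (simp add: algebra_simps)
qed

lemma contour_integral_rectpath_times_m_fn:
  assumes h: "0 < h" and cd: "c < d" and a: "0 < a"
      and P: "finite P" "P \<subseteq> box (Complex c (-a)) (Complex d a)" "P \<inter> \<real> = {}"
      and f: "f analytic_on cbox (Complex c (-a)) (Complex d a) - P"
      and boundary: "path_image (rectpath (Complex c (-a)) (Complex d a)) \<inter> grid h = {}"
  shows "contour_integral (rectpath (Complex c (-a)) (Complex d a)) (\<lambda>u. f u * m_fn h u) =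
      2 * pi * \<i> * (\<Sum>p\<in>P. residue (\<lambda>u. f u * m_fn h u) p)
      + of_real h * (\<Sum>z\<in>grid h \<inter> box (Complex c (-a)) (Complex d a). f z)"
proof -
  let ?R = "box (Complex c (-a)) (Complex d a)"
  let ?m = "\<lambda>u. f u * m_fn h u"
  have ab: "Re (Complex c (-a)) < Re (Complex d a)" "Im (Complex c (-a)) < Im (Complex d a)"
    using cd a by auto
  have grid_P: "grid h \<inter> P = {}" using grid_subset_Reals P(3) by blast
  have fin: "finite (grid h \<inter> ?R)"
    using h by (intro finite_grid_Int_bounded bounded_box) auto
  have "cbox (Complex c (-a)) (Complex d a) = ?R \<union> path_image (rectpath (Complex c (-a)) (Complex d a))"
    using path_image_rectpath_cbox_minus_box[of "Complex c (-a)" "Complex d a"] ab box_subset_cbox by auto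
  then have "?m analytic_on cbox (Complex c (-a)) (Complex d a) - (P \<union> (grid h \<inter> ?R))"
    using h boundary by (intro analytic_on_mult analytic_on_subset[OF f] m_fn_analytic_on) auto
  then have "contour_integral (rectpath (Complex c (-a)) (Complex d a)) ?m
      = 2 * pi * \<i> * (\<Sum>p\<in>P \<union> (grid h \<inter> ?R). residue ?m p)"
    using P fin by (intro Residue_theorem_rectpath ab) auto
  also have "\<dots> = 2 * pi * \<i> * (\<Sum>p\<in>P. residue ?m p) + 2 * pi * \<i> * (\<Sum>z\<in>grid h \<inter> ?R. residue ?m z)"
    using P(1) fin grid_P by (subst sum.union_disjoint) (auto simp: distrib_left)
  also have "(\<Sum>z\<in>grid h \<inter> ?R. residue ?m z) = (\<Sum>z\<in>grid h \<inter> ?R. - (\<i> * of_real h / (2 * of_real pi)) * f z)"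
    using h grid_P box_subset_cbox
    by (intro sum.cong refl residue_times_m_fn_at_grid analytic_on_subset[OF f]) auto
  also have "2 * pi * \<i> * \<dots> = of_real h * (\<Sum>z\<in>grid h \<inter> ?R. f z)"
    unfolding sum_distrib_left [symmetric] by simp
  finally show ?thesis .
qed

lemma residue_times_delta_fn:
  assumes V: "open V" "p \<in> V" and f: "f holomorphic_on V - {p}" and h: "h \<noteq> 0" and p: "p \<notin> \<real>"
  shows "residue (\<lambda>u. f u * delta_fn h u) p = mu_fn p * residue f p - residue (\<lambda>u. f u * m_fn h u) p"
proof -
  have W: "open (V - \<real>)" "p \<in> V - \<real>"
    using V p by (auto intro!: open_Diff closed_complex_Reals)
  have f': "f holomorphic_on V - \<real> - {p}"
    by (rule holomorphic_on_subset[OF f]) auto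
  have mu: "mu_fn holomorphic_on V - \<real> - {p}"
    by (intro analytic_imp_holomorphic mu_fn_analytic_on) auto
  have m: "m_fn h holomorphic_on V - \<real> - {p}"
    using h grid_subset_Reals[of h] by (intro analytic_imp_holomorphic m_fn_analytic_on) auto
  have "residue (\<lambda>u. f u * delta_fn h u) p = residue (\<lambda>u. f u * mu_fn u - f u * m_fn h u) p"
    by (simp add: delta_fn_def right_diff_distrib)
  also have "\<dots> = residue (\<lambda>u. f u * mu_fn u) p - residue (\<lambda>u. f u * m_fn h u) p"
    by (intro residue_diff[OF W] holomorphic_on_mult f' mu m)
  also have "residue (\<lambda>u. f u * mu_fn u) p = residue (\<lambda>u. mu_fn p * f u) p"
  proof (rule residue_cong)
    have "\<forall>\<^sub>F u in at p. mu_fn u = mu_fn p"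
      using eventually_mu_fn_eq[of p] p by (simp add: eventually_nhds_conv_at complex_is_Real_iff)
    then show "\<forall>\<^sub>F u in at p. f u * mu_fn u = mu_fn p * f u"
      by (rule eventually_mono) simp
  qed simp
  also have "\<dots> = mu_fn p * residue f p" by (rule residue_lmul[OF V f])
  finally show ?thesis .
qed

text \<open>Only \<open>\<mu>\<close> jumps across the real axis and only \<open>m\<close> has poles at the nodes, so the two parts of
  \<open>\<delta> = \<mu> - m\<close> are integrated separately.\<close>

lemma contour_integral_rectpath_times_delta_fn:
  assumes h: "0 < h" and cd: "c < d" and a: "0 < a"
      and P: "finite P" "P \<subseteq> box (Complex c (-a)) (Complex d a)" "P \<inter> \<real> = {}"
      and f: "f analytic_on cbox (Complex c (-a)) (Complex d a) - P"
      and boundary: "path_image (rectpath (Complex c (-a)) (Complex d a)) \<inter> grid h = {}"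
  shows "contour_integral (rectpath (Complex c (-a)) (Complex d a)) (\<lambda>u. f u * delta_fn h u) =
      contour_integral (linepath (Complex c 0) (Complex d 0)) f
      - of_real h * (\<Sum>z\<in>grid h \<inter> box (Complex c (-a)) (Complex d a). f z)
      + 2 * pi * \<i> * (\<Sum>p\<in>P. residue (\<lambda>u. f u * delta_fn h u) p)"
proof -
  let ?C = "rectpath (Complex c (-a)) (Complex d a)" and ?R = "box (Complex c (-a)) (Complex d a)"
  have residues: "residue (\<lambda>u. f u * delta_fn h u) p = mu_fn p * residue f p - residue (\<lambda>u. f u * m_fn h u) p"
    if p: "p \<in> P" for p
  proof -
    have "open (?R - (P - {p}))" "p \<in> ?R - (P - {p})" "?R - (P - {p}) - {p} \<subseteq> cbox (Complex c (-a)) (Complex d a) - P"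
      using p P box_subset_cbox[of "Complex c (-a)" "Complex d a"] by (auto intro!: open_Diff finite_imp_closed)
    then show ?thesis
      using p P(3) h by (intro residue_times_delta_fn analytic_imp_holomorphic analytic_on_subset[OF f]) auto
  qed
  have mu: "((\<lambda>u. f u * mu_fn u) has_contour_integral
      contour_integral (linepath (Complex c 0) (Complex d 0)) f
      + 2 * pi * \<i> * (\<Sum>p\<in>P. mu_fn p * residue f p)) ?C"
    by (rule has_contour_integral_rectpath_times_mu_fn) fact+
  have "path_image ?C \<subseteq> cbox (Complex c (-a)) (Complex d a) - P"
    using path_image_rectpath_cbox_minus_box[of "Complex c (-a)" "Complex d a"] cd a P(2) by auto
  then have "(\<lambda>u. f u * m_fn h u) contour_integrable_on ?C"
    using h boundary by (intro analytic_imp_contour_integrable analytic_on_mult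
        analytic_on_subset[OF f] m_fn_analytic_on) auto
  from has_contour_integral_diff[OF mu has_contour_integral_integral[OF this]]
  have "contour_integral ?C (\<lambda>u. f u * delta_fn h u) =
      contour_integral (linepath (Complex c 0) (Complex d 0)) f
      + 2 * pi * \<i> * (\<Sum>p\<in>P. mu_fn p * residue f p) - contour_integral ?C (\<lambda>u. f u * m_fn h u)"
    unfolding delta_fn_def right_diff_distrib by (rule contour_integral_unique)
  also have "contour_integral ?C (\<lambda>u. f u * m_fn h u) =
      2 * pi * \<i> * (\<Sum>p\<in>P. residue (\<lambda>u. f u * m_fn h u) p) + of_real h * (\<Sum>z\<in>grid h \<inter> ?R. f z)"
    by (rule contour_integral_rectpath_times_m_fn) fact+
  finally show ?thesis by (simp add: residues sum_subtractf right_diff_distrib)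
qed

section \<open>Poles and residues of the integrand\<close>

definition f_int_pole :: "real \<Rightarrow> real \<Rightarrow> int \<Rightarrow> complex" where
  "f_int_pole T x k = (Complex (T + ln x / 2) (of_int k * pi / 2))\<^sup>2"

lemma Re_f_int_pole: "Re (f_int_pole T x k) = (T + ln x / 2)\<^sup>2 - of_int (k\<^sup>2) * pi\<^sup>2 / 4"
  by (simp add: f_int_pole_def power2_eq_square)

lemma Im_f_int_pole: "Im (f_int_pole T x k) = of_int k * pi * (T + ln x / 2)"
  by (simp add: f_int_pole_def power2_eq_square)

lemma csqrt_f_int_pole:
  assumes "0 < T + ln x / 2"
  shows "csqrt (f_int_pole T x k) = Complex (T + ln x / 2) (of_int k * pi / 2)"
  unfolding f_int_pole_def by (rule csqrt_square) (use assms in simp)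

lemma exp_double_diff_plus_eq_0_iff:
  assumes "0 < x"
  shows "exp (2 * (w - of_real T)) + of_real x = 0 \<longleftrightarrow>
    (\<exists>k. odd k \<and> w = Complex (T + ln x / 2) (of_int k * pi / 2))"
proof -
  have minus_x: "exp (Complex (ln x) pi) = - of_real x"
    using assms by (simp add: complex_eq_iff Re_exp Im_exp)
  have "exp (2 * (w - of_real T)) + of_real x = 0 \<longleftrightarrow>
      exp (2 * (w - of_real T)) = exp (Complex (ln x) pi)"
    unfolding minus_x by (simp only: eq_neg_iff_add_eq_0)
  also have "\<dots> \<longleftrightarrow> (\<exists>n::int. 2 * (w - of_real T) = Complex (ln x) pi + (of_int (2 * n) * pi) * \<i>)"
    by (rule exp_eq)
  also have "\<dots> \<longleftrightarrow> (\<exists>n::int. w = Complex (T + ln x / 2) (of_int (2 * n + 1) * pi / 2))"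
    by (intro ex_cong1) (auto simp: complex_eq_iff algebra_simps)
  also have "\<dots> \<longleftrightarrow> (\<exists>k. odd k \<and> w = Complex (T + ln x / 2) (of_int k * pi / 2))"
    by (metis oddE odd_two_times_div_two_succ even_plus_one_iff dvd_triv_left)
  finally show ?thesis .
qed

lemma f_int_analytic_on:
  assumes x: "0 < x" and S: "S \<inter> \<real>\<^sub>\<le>\<^sub>0 = {}"
      and no_pole: "\<And>k. odd k \<Longrightarrow> f_int_pole T x k \<notin> S"
  shows "(\<lambda>u. f_int T u x) analytic_on S"
proof -
  have "u \<notin> \<real>\<^sub>\<le>\<^sub>0" "csqrt u \<noteq> 0" if "u \<in> S" for u
    using S that by auto
  moreover have "exp (2 * (csqrt u - of_real T)) + of_real x \<noteq> 0" if "u \<in> S" for u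
  proof
    assume "exp (2 * (csqrt u - of_real T)) + of_real x = 0"
    then obtain k where "odd k" "csqrt u = Complex (T + ln x / 2) (of_int k * pi / 2)"
      using x exp_double_diff_plus_eq_0_iff by blast
    then show False using no_pole that power2_csqrt[of u] by (auto simp: f_int_pole_def)
  qed
  ultimately show ?thesis
    unfolding f_int_def by (intro analytic_intros) auto
qed

lemma residue_f_int_times:
  assumes x: "0 < x" and v: "v \<notin> \<real>\<^sub>\<le>\<^sub>0" and g: "g analytic_on {v}"
      and zero: "exp (2 * (csqrt v - of_real T)) + of_real x = 0"
  shows "residue (\<lambda>u. f_int T u x * g u) v = - (exp (csqrt v - of_real T) / of_real pi) * g v"
proof -
  define num where "num = (\<lambda>u. of_real x / of_real pi * (1 / csqrt u) * exp (csqrt u - of_real T) * g u)"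
  define den where "den = (\<lambda>u. exp (2 * (csqrt u - of_real T)) + complex_of_real x)"
  have csqrt_v: "csqrt v \<noteq> 0" using v by auto
  have quotient: "(\<lambda>u. f_int T u x * g u) = (\<lambda>u. num u / den u)"
    by (auto simp: f_int_def num_def den_def)
  have "residue (\<lambda>u. num u / den u) v = num v / (- of_real x / csqrt v)"
  proof (rule residue_simple_zero_denominator)
    show "num analytic_on {v}" unfolding num_def
      using v csqrt_v by (intro analytic_intros g) auto
    show "den analytic_on {v}" unfolding den_def
      using v by (intro analytic_intros) auto
    have "exp (2 * (csqrt v - of_real T)) = - of_real x"
      using zero by (simp only: eq_neg_iff_add_eq_0)
    moreover have "(den has_field_derivative exp (2 * (csqrt v - of_real T)) / csqrt v) (at v)"
      unfolding den_def using v by (auto intro!: derivative_eq_intros)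
    ultimately show "(den has_field_derivative - of_real x / csqrt v) (at v)"
      by (simp only:)
  qed (use zero x csqrt_v in \<open>auto simp: den_def\<close>)
  also have "\<dots> = - (exp (csqrt v - of_real T) / of_real pi) * g v"
    unfolding num_def using x csqrt_v by (simp add: field_simps)
  finally show ?thesis unfolding quotient .
qed

lemma norm_residue_f_int_times_at_pole:
  assumes x: "0 < x" and b: "0 < T + ln x / 2" and k: "odd k" and g: "g analytic_on {f_int_pole T x k}"
  shows "norm (residue (\<lambda>u. f_int T u x * g u) (f_int_pole T x k)) = sqrt x / pi * norm (g (f_int_pole T x k))"
proof -
  let ?v = "f_int_pole T x k"
  have "Im ?v \<noteq> 0" unfolding Im_f_int_pole using b k by auto
  then have "?v \<notin> \<real>\<^sub>\<le>\<^sub>0" by (auto simp: complex_nonpos_Reals_iff)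
  moreover have "exp (2 * (csqrt ?v - of_real T)) + of_real x = 0"
    unfolding exp_double_diff_plus_eq_0_iff[OF x] csqrt_f_int_pole[OF b] using k by blast
  ultimately have "residue (\<lambda>u. f_int T u x * g u) ?v = - (exp (csqrt ?v - of_real T) / of_real pi) * g ?v"
    by (intro residue_f_int_times x g)
  moreover have "norm (exp (csqrt ?v - of_real T)) = sqrt x"
    using x ln_sqrt[of x, symmetric] by (simp add: csqrt_f_int_pole[OF b] exp_ln)
  ultimately show ?thesis by (simp add: norm_mult norm_divide)
qed

section \<open>The integral along the real axis\<close>

definition quadrature_integrand :: "real \<Rightarrow> real \<Rightarrow> real \<Rightarrow> real" where
  "quadrature_integrand T y x =
     x / pi * (1 / sqrt y) * (exp (sqrt y - T) / (exp (2 * (sqrt y - T)) + x))"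

definition quadrature_antiderivative :: "real \<Rightarrow> real \<Rightarrow> real \<Rightarrow> real" where
  "quadrature_antiderivative T y x = 2 * sqrt x / pi * arctan (exp (sqrt y - T) / sqrt x)"

lemma f_int_of_real:
  assumes "0 \<le> y"
  shows "f_int T (of_real y) x = of_real (quadrature_integrand T y x)"
  using assms by (simp add: f_int_def quadrature_integrand_def csqrt_of_real flip: exp_of_real)

lemma quadrature_antiderivative_has_real_derivative:
  assumes x: "0 < x" and y: "0 < y"
  shows "((\<lambda>y. quadrature_antiderivative T y x) has_real_derivative quadrature_integrand T y x) (at y)"
proof -
  define r where "r = sqrt x"
  define e where "e = exp (sqrt y - T)"
  define D where "D = e\<^sup>2 + x"
  have r: "0 < r" "r\<^sup>2 = x" using x by (auto simp: r_def)
  have D: "0 < D" using x by (auto simp: D_def intro: add_nonneg_pos)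
  have "((\<lambda>y. quadrature_antiderivative T y x) has_real_derivative
      2 * r / pi * (inverse (1 + (e / r)\<^sup>2) * (e * (inverse (sqrt y) / 2) / r))) (at y)"
    unfolding quadrature_antiderivative_def e_def r_def
    by (rule derivative_eq_intros refl | use x y in simp)+
  also have "1 + (e / r)\<^sup>2 = D / x"
    using x by (simp add: D_def power_divide r(2) add_divide_distrib)
  also have "2 * r / pi * (inverse (D / x) * (e * (inverse (sqrt y) / 2) / r)) = x / pi * (1 / sqrt y) * (e / D)"
    using r(1) D x y by (simp add: field_simps)
  also have "\<dots> = quadrature_integrand T y x"
    unfolding quadrature_integrand_def e_def D_def exp_double ..
  finally show ?thesis .
qed

lemma contour_integral_f_int_real_segment:
  assumes x: "0 < x" and cd: "0 < c" "c < d"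
  shows "contour_integral (linepath (Complex c 0) (Complex d 0)) (\<lambda>u. f_int T u x) =
     of_real (quadrature_antiderivative T d x - quadrature_antiderivative T c x)"
    (is "_ = of_real ?I")
proof -
  have "((\<lambda>y. quadrature_integrand T y x) has_integral ?I) {c..d}"
  proof (rule fundamental_theorem_of_calculus)
    show "((\<lambda>y. quadrature_antiderivative T y x) has_vector_derivative quadrature_integrand T y x) (at y within {c..d})"
      if "y \<in> {c..d}" for y
      unfolding has_real_derivative_iff_has_vector_derivative [symmetric]
      by (rule has_field_derivative_at_within, rule quadrature_antiderivative_has_real_derivative)
         (use x cd that in auto)
  qed (use cd in simp)
  then have "((\<lambda>y. complex_of_real (quadrature_integrand T y x)) has_integral of_real ?I) {c..d}"
    by (rule has_integral_of_real)
  then have "((\<lambda>y. f_int T (of_real y) x) has_integral of_real ?I) {c..d}"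
    by (rule has_integral_eq[rotated]) (use cd in \<open>simp add: f_int_of_real\<close>)
  then have "((\<lambda>u. f_int T u x) has_contour_integral of_real ?I) (linepath (Complex c 0) (Complex d 0))"
    using cd by (subst has_contour_integral_linepath_Reals_iff) (auto simp: complex_is_Real_iff)
  then show ?thesis by (rule contour_integral_unique)
qed

lemma quadrature_truncation_error:
  assumes x: "0 < x" "x \<le> 1"
  shows "\<bar>quadrature_antiderivative T d x - quadrature_antiderivative T c x - sqrt x\<bar>
    \<le> exp (T - sqrt d) + exp (sqrt c - T)"
proof -
  define r where "r = sqrt x"
  have r: "0 < r" "r * r = x" using x by (auto simp: r_def)
  define p where "p = exp (T - sqrt d)"
  define q where "q = exp (sqrt c - T)"
  have pq: "0 < p" "0 < q" by (auto simp: p_def q_def)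
  have "exp (sqrt d - T) / r = inverse (p * r)"
    by (simp add: p_def exp_diff exp_minus field_simps)
  then have arctan_d: "arctan (exp (sqrt d - T) / r) = pi / 2 - arctan (p * r)"
    using arctan_inverse[of "p * r"] r pq by (simp add: sgn_if inverse_eq_divide)
  have "quadrature_antiderivative T d x - quadrature_antiderivative T c x - r
      = - (2 * r / pi * (arctan (p * r) + arctan (q / r)))"
    unfolding quadrature_antiderivative_def r_def [symmetric] q_def [symmetric] arctan_d
    by (simp add: field_simps)
  moreover have "0 \<le> 2 * r / pi * (arctan (p * r) + arctan (q / r))"
    using r pq by (intro mult_nonneg_nonneg add_nonneg_nonneg) auto
  moreover have "2 * r / pi * (arctan (p * r) + arctan (q / r)) \<le> 2 * r / pi * (p * r + q / r)"
    using r pq by (intro mult_left_mono add_mono arctan_le_self) auto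
  moreover have "2 * r / pi * (p * r + q / r) = 2 / pi * (p * x + q)"
    using r by (simp add: field_simps)
  moreover have "2 / pi * (p * x + q) \<le> 1 * (p * 1 + q)"
    using x pq pi_ge_two by (intro mult_mono add_mono) auto
  ultimately show ?thesis by (simp add: p_def q_def r_def)
qed

section \<open>The trapezoidal error\<close>

definition trapezoidal_sum :: "real \<Rightarrow> nat \<Rightarrow> real \<Rightarrow> real \<Rightarrow> real" where
  "trapezoidal_sum h n T x = h * (\<Sum>j=1..n. quadrature_integrand T (real j * h) x)"

lemma grid_Int_box_eq:
  assumes c: "0 \<le> c" "c < h" and d: "real n * h < d" "d \<le> real (Suc n) * h" and a: "0 < a"
  shows "grid h \<inter> box (Complex c (-a)) (Complex d a) = (\<lambda>j. of_real (real j * h)) ` {1..n}"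
proof (intro equalityI subsetI)
  fix u assume u: "u \<in> grid h \<inter> box (Complex c (-a)) (Complex d a)"
  then obtain k :: int where k: "u = of_real (of_int k * h)" by (auto simp: grid_def)
  have kh: "c < of_int k * h" "of_int k * h < d"
    using u by (auto simp: k in_box_complex_iff)
  have "0 < of_int k * h" "of_int k * h < of_int (int n + 1) * h"
    using kh c d by (auto simp: algebra_simps)
  then have "0 < k" "k < int n + 1"
    using c by (simp_all add: zero_less_mult_iff mult_less_cancel_right)
  then have "u = of_real (real (nat k) * h)" "nat k \<in> {1..n}" using k by auto
  then show "u \<in> (\<lambda>j. of_real (real j * h)) ` {1..n}" by blast
next
  fix u :: complex assume "u \<in> (\<lambda>j. of_real (real j * h)) ` {1..n}"
  then obtain j where j: "u = of_real (real j * h)" "j \<in> {1..n}" by blast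
  have "1 * h \<le> real j * h" "real j * h \<le> real n * h"
    using j c by (auto intro!: mult_right_mono)
  then have "c < real j * h" "real j * h < d" using c d by linarith+
  moreover have "u \<in> grid h" by (auto simp: grid_def j(1) intro!: image_eqI[of _ _ "int j"])
  ultimately show "u \<in> grid h \<inter> box (Complex c (-a)) (Complex d a)"
    using a by (auto simp: j(1) in_box_complex_iff)
qed

lemma path_image_rectpath_Int_grid_eq_empty:
  assumes c: "0 < c" "c < h" and d: "real n * h < d" "d < real (Suc n) * h" and cd: "c \<le> d" and a: "0 < a"
  shows "path_image (rectpath (Complex c (-a)) (Complex d a)) \<inter> grid h = {}"
proof -
  have "of_int k * h \<notin> {real m * h<..<real (Suc m) * h}" for k :: int and m
  proof -
    have "k \<le> int m \<or> int (Suc m) \<le> k" by linarith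
    then have "of_int k \<le> real m \<or> real (Suc m) \<le> of_int k" by linarith
    then have "of_int k * h \<le> real m * h \<or> real (Suc m) * h \<le> of_int k * h"
      using c by (auto intro: mult_right_mono)
    then show ?thesis by auto
  qed
  moreover have "c \<in> {real 0 * h<..<real (Suc 0) * h}" "d \<in> {real n * h<..<real (Suc n) * h}"
    using c d by auto
  ultimately have "of_int k * h \<notin> {c, d}" for k :: int
    by blast
  moreover have "\<exists>k::int. Re u = of_int k * h \<and> Im u = 0" if "u \<in> grid h" for u
    using that by (auto simp: grid_def)
  ultimately have "Re u \<notin> {c, d} \<and> Im u = 0" if "u \<in> grid h" for u
    using that by metis
  then show ?thesis
    using a cd by (subst path_image_rectpath) fastforce+
qed

lemma sum_f_int_nodes_eq_trapezoidal_sum: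
  assumes h: "0 < h"
  shows "of_real h * (\<Sum>z\<in>(\<lambda>j. of_real (real j * h)) ` {1..n}. f_int T z x) = of_real (trapezoidal_sum h n T x)"
proof -
  have "(\<Sum>z\<in>(\<lambda>j. complex_of_real (real j * h)) ` {1..n}. f_int T z x)
      = (\<Sum>j=1..n. f_int T (of_real (real j * h)) x)"
    using h by (subst sum.reindex) (auto simp: inj_on_def)
  also have "\<dots> = (\<Sum>j=1..n. of_real (quadrature_integrand T (real j * h) x))"
    using h by (intro sum.cong refl f_int_of_real) auto
  finally show ?thesis by (simp add: trapezoidal_sum_def)
qed

lemma f_int_analytic_on_cbox:
  assumes x: "0 < x" and b: "0 < T + ln x / 2" and c: "0 < c" and a: "a = 2 * pi * (T + ln x / 2)"
  shows "(\<lambda>u. f_int T u x) analytic_on cbox (Complex c (-a)) (Complex d a) - f_int_pole T x ` {1, -1}"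
proof (rule f_int_analytic_on)
  fix k :: int assume k: "odd k"
  show "f_int_pole T x k \<notin> cbox (Complex c (-a)) (Complex d a) - f_int_pole T x ` {1, -1}"
  proof
    assume "f_int_pole T x k \<in> cbox (Complex c (-a)) (Complex d a) - f_int_pole T x ` {1, -1}"
    then have "\<bar>of_int k * (a / 2)\<bar> \<le> 2 * (a / 2)" "k \<notin> {1, -1}"
      by (auto simp: in_cbox_complex_iff Im_f_int_pole a algebra_simps abs_le_iff)
    moreover have "0 < a" using a b by simp
    ultimately have "\<bar>real_of_int k\<bar> \<le> 2" "k \<notin> {1, -1}" by (simp_all add: abs_mult)
    then have "k \<in> {-2..2}" "k \<notin> {1, -1}" by auto
    moreover have "{-2..2} = {-2,-1,0,1,2::int}" by auto
    ultimately show False using k by auto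
  qed
qed (use x c in \<open>auto simp: in_cbox_complex_iff complex_nonpos_Reals_iff\<close>)

lemma f_int_pole_in_box:
  assumes b: "2 \<le> T + ln x / 2" and x: "0 < x" "x \<le> 1" and k: "k \<in> {1, -1}"
  shows "f_int_pole T x k \<in> box (Complex 1 (- (2 * pi * (T + ln x / 2))))
    (Complex (4 * T\<^sup>2 + 1) (2 * pi * (T + ln x / 2)))"
proof -
  define b where "b = T + ln x / 2"
  have b2: "2 \<le> b" "b \<le> T" using b x by (auto simp: b_def)
  have "4 \<le> b\<^sup>2" "b\<^sup>2 \<le> T\<^sup>2"
    using power_mono[of 2 b 2] power_mono[of b T 2] b2 by simp_all
  moreover have "pi\<^sup>2 < 12"
    using power_strict_mono[of pi "3.2" 2] pi_approx by (simp add: power2_eq_square)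
  moreover have "0 \<le> pi\<^sup>2" "0 \<le> T\<^sup>2" by simp_all
  moreover have "Re (f_int_pole T x k) = b\<^sup>2 - pi\<^sup>2 / 4"
    using k by (auto simp: Re_f_int_pole b_def)
  ultimately have Re: "1 < Re (f_int_pole T x k)" "Re (f_int_pole T x k) < 4 * T\<^sup>2 + 1"
    by linarith+
  have "\<bar>Im (f_int_pole T x k)\<bar> = pi * b"
    using k b2 by (auto simp: Im_f_int_pole b_def)
  then have "\<bar>Im (f_int_pole T x k)\<bar> < 2 * pi * b" using b2 by simp
  with Re show ?thesis
    by (auto simp: in_box_complex_iff abs_less_iff simp flip: b_def)
qed

lemma contour_integral_Gamma_path_eq:
  assumes h: "1 < h" and T: "4 * T\<^sup>2 = real n * h"
      and x: "0 < x" "x \<le> 1" and b: "2 \<le> T + ln x / 2"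
  shows "contour_integral (Gamma_path T x) (\<lambda>u. f_int T u x * delta_fn h u) =
     of_real (quadrature_antiderivative T (4 * T\<^sup>2 + 1) x - quadrature_antiderivative T 1 x - trapezoidal_sum h n T x)
     + 2 * pi * \<i> * (\<Sum>k\<in>{1,-1}. residue (\<lambda>u. f_int T u x * delta_fn h u) (f_int_pole T x k))"
proof -
  define a where "a = 2 * pi * (T + ln x / 2)"
  define R where "R = 4 * T\<^sup>2 + 1"
  define P where "P = f_int_pole T x ` {1, -1}"
  have a: "0 < a" using b by (simp add: a_def)
  have "ln x \<le> 0" using x by simp
  then have "0 < T" using b by linarith
  then have R: "1 < R" by (simp add: R_def)
  have P_box: "P \<subseteq> box (Complex 1 (-a)) (Complex R a)"
    unfolding P_def a_def R_def using f_int_pole_in_box[OF b x] by blast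
  have P_nonreal: "P \<inter> \<real> = {}"
    using b by (auto simp: P_def complex_is_Real_iff Im_f_int_pole)
  have inj: "inj_on (f_int_pole T x) {1, -1}"
    using b by (auto simp: inj_on_def dest!: arg_cong[where f = Im] simp: Im_f_int_pole)
  have analytic: "(\<lambda>u. f_int T u x) analytic_on cbox (Complex 1 (-a)) (Complex R a) - P"
    unfolding P_def using x b by (intro f_int_analytic_on_cbox) (auto simp: a_def)
  have nodes: "grid h \<inter> box (Complex 1 (-a)) (Complex R a) = (\<lambda>j. of_real (real j * h)) ` {1..n}"
    using h T a by (intro grid_Int_box_eq) (auto simp: R_def algebra_simps)
  have boundary: "path_image (rectpath (Complex 1 (-a)) (Complex R a)) \<inter> grid h = {}"
    using h T a by (intro path_image_rectpath_Int_grid_eq_empty[of _ _ n]) (auto simp: R_def algebra_simps)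
  have "Gamma_path T x = rectpath (Complex 1 (-a)) (Complex R a)"
    by (simp add: Gamma_path_def rectpath_def Let_def a_def R_def)
  then have "contour_integral (Gamma_path T x) (\<lambda>u. f_int T u x * delta_fn h u) =
      contour_integral (linepath (Complex 1 0) (Complex R 0)) (\<lambda>u. f_int T u x)
      - of_real h * (\<Sum>z\<in>(\<lambda>j. of_real (real j * h)) ` {1..n}. f_int T z x)
      + 2 * pi * \<i> * (\<Sum>p\<in>P. residue (\<lambda>u. f_int T u x * delta_fn h u) p)"
    unfolding nodes [symmetric]
    using h R a P_box P_nonreal analytic boundary
    by (simp only:) (rule contour_integral_rectpath_times_delta_fn, auto simp: P_def)
  also have "contour_integral (linepath (Complex 1 0) (Complex R 0)) (\<lambda>u. f_int T u x)
      = of_real (quadrature_antiderivative T R x - quadrature_antiderivative T 1 x)"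
    using x R by (intro contour_integral_f_int_real_segment) auto
  also have "of_real h * (\<Sum>z\<in>(\<lambda>j. of_real (real j * h)) ` {1..n}. f_int T z x) = of_real (trapezoidal_sum h n T x)"
    using h by (intro sum_f_int_nodes_eq_trapezoidal_sum) simp
  also have "(\<Sum>p\<in>P. residue (\<lambda>u. f_int T u x * delta_fn h u) p)
      = (\<Sum>k\<in>{1,-1}. residue (\<lambda>u. f_int T u x * delta_fn h u) (f_int_pole T x k))"
    unfolding P_def by (subst sum.reindex[OF inj]) simp
  finally show ?thesis by (simp add: R_def)
qed

lemma norm_residue_f_int_times_delta_fn_le:
  assumes x: "0 < x" and b: "1 \<le> T + ln x / 2" and k: "k \<in> {1, -1}"
  shows "norm (residue (\<lambda>u. f_int T u x * delta_fn (2 * pi\<^sup>2) u) (f_int_pole T x k)) \<le> 2 / pi * exp (- T)"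
proof -
  let ?p = "f_int_pole T x k"
  define b where "b = T + ln x / 2"
  have b1: "1 \<le> b" using b by (simp add: b_def)
  have Im: "\<bar>Im ?p\<bar> = pi * b"
    using k b1 by (auto simp: Im_f_int_pole b_def)
  then have Im_nz: "Im ?p \<noteq> 0" using b1 by auto
  have "2 * pi * \<bar>Im ?p\<bar> / (2 * pi\<^sup>2) = b"
    unfolding Im by (simp add: power2_eq_square)
  then have "norm (delta_fn (2 * pi\<^sup>2) ?p) \<le> 1 / (exp b - 1)"
    using norm_delta_fn_le[of "2 * pi\<^sup>2" ?p] Im_nz by simp
  also have "\<dots> \<le> 2 * exp (- b)"
  proof -
    have "exp b / 2 \<le> exp b - 1" using exp_ge_add_one_self[of b] b1 by linarith
    then have "1 / (exp b - 1) \<le> 1 / (exp b / 2)" by (intro frac_le) auto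
    then show ?thesis by (simp add: exp_minus field_simps)
  qed
  finally have delta: "norm (delta_fn (2 * pi\<^sup>2) ?p) \<le> 2 * exp (- b)" .
  have "norm (residue (\<lambda>u. f_int T u x * delta_fn (2 * pi\<^sup>2) u) ?p) = sqrt x / pi * norm (delta_fn (2 * pi\<^sup>2) ?p)"
    by (rule norm_residue_f_int_times_at_pole)
       (use x b k Im_nz in \<open>auto intro!: delta_fn_analytic_on simp: complex_is_Real_iff\<close>)
  also have "\<dots> \<le> sqrt x / pi * (2 * exp (- b))"
    using x delta by (intro mult_left_mono) auto
  also have "\<dots> = 2 / pi * (exp (ln x / 2) * exp (- b))"
    using x ln_sqrt[of x, symmetric] by (simp add: exp_ln)
  also have "exp (ln x / 2) * exp (- b) = exp (- T)"
    by (simp add: b_def flip: exp_add)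
  finally show ?thesis .
qed

lemma trapezoidal_error_le_contour_integral:
  assumes h: "h = 2 * pi\<^sup>2" and T: "4 * T\<^sup>2 = real n * h"
      and x: "exp (4 - 2 * T) \<le> x" "x \<le> 1"
  shows "\<bar>trapezoidal_sum h n T x - sqrt x\<bar>
     \<le> norm (contour_integral (Gamma_path T x) (\<lambda>u. f_int T u x * delta_fn h u)) + 12 * exp (- T)"
proof -
  define I where "I = quadrature_antiderivative T (4 * T\<^sup>2 + 1) x - quadrature_antiderivative T 1 x"
  define \<rho> where "\<rho> = 2 * pi * \<i> * (\<Sum>k\<in>{1,-1}. residue (\<lambda>u. f_int T u x * delta_fn h u) (f_int_pole T x k))"
  have x0: "0 < x" using x(1) exp_gt_zero[of "4 - 2 * T"] by linarith
  then have "4 - 2 * T \<le> ln x" using x(1) by (simp add: ln_ge_iff)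
  then have b: "2 \<le> T + ln x / 2" by simp
  have "1 < pi\<^sup>2" using pi_gt3 by (intro one_less_power) auto
  then have h1: "1 < h" unfolding h by linarith
  have "of_real (trapezoidal_sum h n T x - I) =
      \<rho> - contour_integral (Gamma_path T x) (\<lambda>u. f_int T u x * delta_fn h u)"
    unfolding contour_integral_Gamma_path_eq[OF h1 T x0 x(2) b] by (simp add: I_def \<rho>_def)
  then have "\<bar>trapezoidal_sum h n T x - I\<bar> \<le>
      norm \<rho> + norm (contour_integral (Gamma_path T x) (\<lambda>u. f_int T u x * delta_fn h u))"
    by (metis norm_of_real norm_triangle_ineq4)
  moreover have "norm \<rho> \<le> 8 * exp (- T)"
  proof -
    have "norm \<rho> = 2 * pi * norm (\<Sum>k\<in>{1,-1}. residue (\<lambda>u. f_int T u x * delta_fn h u) (f_int_pole T x k))"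
      by (simp add: \<rho>_def norm_mult)
    also have "\<dots> \<le> 2 * pi * (\<Sum>k\<in>{1,-1::int}. 2 / pi * exp (- T))"
      unfolding h using x0 b
      by (intro mult_left_mono sum_norm_le norm_residue_f_int_times_delta_fn_le) auto
    finally show ?thesis by simp
  qed
  moreover have "\<bar>I - sqrt x\<bar> \<le> 4 * exp (- T)"
  proof -
    have "2 * T \<le> sqrt (4 * T\<^sup>2 + 1)" by (rule real_le_rsqrt) (simp add: power_mult_distrib)
    then have "exp (T - sqrt (4 * T\<^sup>2 + 1)) \<le> exp (- T)" by simp
    moreover have "exp (sqrt 1 - T) \<le> 3 * exp (- T)"
      using exp_le by (simp add: exp_diff exp_minus field_simps)
    ultimately show ?thesis
      using quadrature_truncation_error[OF x0 x(2), of T "4 * T\<^sup>2 + 1" 1] unfolding I_def by linarith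
  qed
  ultimately show ?thesis by linarith
qed

section \<open>The trapezoidal sum as a sum of simple fractions\<close>

definition quadrature_weight :: "real \<Rightarrow> real \<Rightarrow> nat \<Rightarrow> real" where
  "quadrature_weight h T j = h / (pi * sqrt (real j * h)) * exp (sqrt (real j * h) - T)"

definition quadrature_shift :: "real \<Rightarrow> real \<Rightarrow> nat \<Rightarrow> real" where
  "quadrature_shift h T j = exp (2 * (sqrt (real j * h) - T))"

lemma quadrature_weight_nonneg: "0 \<le> h \<Longrightarrow> 0 \<le> quadrature_weight h T j"
  by (simp add: quadrature_weight_def)

lemma trapezoidal_sum_eq_simple_fractions:
  "trapezoidal_sum h n T x = (\<Sum>j=1..n. quadrature_weight h T j * (x / (quadrature_shift h T j + x)))"
  unfolding trapezoidal_sum_def sum_distrib_left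
  by (intro sum.cong refl) (simp add: quadrature_integrand_def quadrature_weight_def quadrature_shift_def)

lemma pole_eq_quadrature_shift:
  "pole N j = - quadrature_shift (2 * pi\<^sup>2) (pi * sqrt (2 * real N)) j"
  by (simp add: pole_def sigma_c_def quadrature_shift_def real_sqrt_mult algebra_simps)

lemma one_le_quadrature_shift:
  assumes "N \<le> j"
  shows "1 \<le> quadrature_shift (2 * pi\<^sup>2) (pi * sqrt (2 * real N)) j"
  using assms by (simp add: quadrature_shift_def real_sqrt_mult mult.commute mult_left_mono)

lemma sum_exp_minus_sqrt_le:
  assumes h: "0 < h"
  shows "(\<Sum>j=1..n. h / sqrt (real j * h) * exp (- sqrt (real j * h))) \<le> 2"
proof -
  have "(\<Sum>j=1..n. h / sqrt (real j * h) * exp (- sqrt (real j * h))) \<le> 2 - 2 * exp (- sqrt (real n * h))"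
  proof (induction n)
    case (Suc n)
    define s where "s = sqrt (real n * h)"
    define t where "t = sqrt (real (Suc n) * h)"
    have t0: "0 < t" and st: "s \<le> t"
      using h by (auto simp: s_def t_def)
    have "h = t\<^sup>2 - s\<^sup>2" using h by (simp add: s_def t_def algebra_simps)
    also have "\<dots> = (t + s) * (t - s)" by (simp add: power2_eq_square algebra_simps)
    also have "\<dots> \<le> (2 * t) * (t - s)" using st by (intro mult_right_mono) auto
    finally have "h / t \<le> 2 * (t - s)" using t0 by (simp add: field_simps)
    also have "\<dots> \<le> 2 * (exp (t - s) - 1)"
      using exp_ge_add_one_self[of "t - s"] by (intro mult_left_mono) (simp_all add: algebra_simps)
    finally have "h / t * exp (- t) \<le> 2 * (exp (t - s) - 1) * exp (- t)"
      by (rule mult_right_mono) simp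
    also have "\<dots> = 2 * exp (- s) - 2 * exp (- t)"
      by (simp add: algebra_simps flip: exp_add)
    finally show ?case using Suc.IH unfolding s_def t_def by simp
  qed simp
  then show ?thesis using exp_gt_zero[of "- sqrt (real n * h)"] by linarith
qed

lemma sum_quadrature_weight_over_shift_le:
  assumes h: "0 < h"
  shows "(\<Sum>j=1..n. quadrature_weight h T j / quadrature_shift h T j) \<le> exp T"
proof -
  have "quadrature_weight h T j / quadrature_shift h T j
      = exp T / pi * (h / sqrt (real j * h) * exp (- sqrt (real j * h)))" for j
  proof -
    have "exp (sqrt (real j * h) - T) / quadrature_shift h T j = exp T * exp (- sqrt (real j * h))"
      by (simp add: quadrature_shift_def flip: exp_diff exp_add)
    then show ?thesis
      unfolding quadrature_weight_def times_divide_eq_right [symmetric] by (simp add: mult_ac)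
  qed
  then have "(\<Sum>j=1..n. quadrature_weight h T j / quadrature_shift h T j)
      = exp T / pi * (\<Sum>j=1..n. h / sqrt (real j * h) * exp (- sqrt (real j * h)))"
    by (simp only: sum_distrib_left)
  also have "\<dots> \<le> exp T / pi * 2"
    by (intro mult_left_mono sum_exp_minus_sqrt_le h) auto
  also have "\<dots> \<le> exp T" using pi_ge_two by (simp add: field_simps)
  finally show ?thesis .
qed

lemma
  assumes h: "0 < h" and x: "0 \<le> x"
  shows trapezoidal_sum_nonneg: "0 \<le> trapezoidal_sum h n T x"
    and trapezoidal_sum_le: "trapezoidal_sum h n T x \<le> x * exp T"
proof -
  have shift: "0 < quadrature_shift h T j" for j by (simp add: quadrature_shift_def)
  have weight: "0 \<le> quadrature_weight h T j" for j using h by (simp add: quadrature_weight_nonneg)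
  show "0 \<le> trapezoidal_sum h n T x"
    unfolding trapezoidal_sum_eq_simple_fractions
    using x shift weight by (intro sum_nonneg mult_nonneg_nonneg divide_nonneg_nonneg add_nonneg_nonneg) (auto intro: less_imp_le)
  have "quadrature_weight h T j * (x / (quadrature_shift h T j + x))
      \<le> x * (quadrature_weight h T j / quadrature_shift h T j)" for j
  proof -
    have "x / (quadrature_shift h T j + x) \<le> x / quadrature_shift h T j"
      using x shift[of j] by (intro divide_left_mono mult_pos_pos add_pos_nonneg) auto
    from mult_left_mono[OF this weight[of j]] show ?thesis by (simp add: mult.commute)
  qed
  then have "trapezoidal_sum h n T x \<le> x * (\<Sum>j=1..n. quadrature_weight h T j / quadrature_shift h T j)"
    unfolding trapezoidal_sum_eq_simple_fractions sum_distrib_left by (intro sum_mono)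
  also have "\<dots> \<le> x * exp T"
    using x by (intro mult_left_mono sum_quadrature_weight_over_shift_le h)
  finally show "trapezoidal_sum h n T x \<le> x * exp T" .
qed

lemma trapezoidal_error_near_zero:
  assumes h: "0 < h" and x: "0 \<le> x" "x \<le> exp (4 - 2 * T)"
  shows "\<bar>trapezoidal_sum h n T x - sqrt x\<bar> \<le> exp 4 * exp (- T)"
proof -
  have "x * exp T \<le> exp (4 - 2 * T) * exp T" using x by simp
  also have "\<dots> = exp 4 * exp (- T)" by (simp flip: exp_add)
  finally have "trapezoidal_sum h n T x \<le> exp 4 * exp (- T)"
    using trapezoidal_sum_le[OF h x(1), of n T] by linarith
  moreover have "sqrt x \<le> exp 4 * exp (- T)"
  proof -
    have "sqrt x \<le> sqrt ((exp (2 - T))\<^sup>2)"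
      using x by (intro real_sqrt_le_mono) (simp flip: exp_double)
    also have "\<dots> \<le> exp 4 * exp (- T)" by (simp flip: exp_add)
    finally show ?thesis .
  qed
  moreover have "0 \<le> sqrt x" using x by simp
  ultimately show ?thesis
    using trapezoidal_sum_nonneg[OF h x(1), of n T] by linarith
qed

section \<open>Polynomial approximation of simple fractions\<close>

lemma fraction_minus_geometric_sum:
  fixes q x m :: real
  assumes "q + m \<noteq> 0" "q + x \<noteq> 0"
  shows "x / (q + x) - x / (q + m) * (\<Sum>k<n. ((m - x) / (q + m)) ^ k) = x / (q + x) * ((m - x) / (q + m)) ^ n"
proof -
  define z where "z = (m - x) / (q + m)"
  have z: "1 - z = (q + x) / (q + m)" using assms by (simp add: z_def field_simps)
  then have "1 - z \<noteq> 0" using assms by simp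
  then have "x / (q + m) * (\<Sum>k<n. z ^ k) = x / (q + m) * ((1 - z ^ n) / (1 - z))"
    by (simp add: sum_gp_strict)
  also have "\<dots> = x / (q + x) * (1 - z ^ n)"
    unfolding z using assms by simp
  finally show ?thesis by (simp add: z_def right_diff_distrib)
qed

text \<open>Geometric series about the midpoint \<open>1/2\<close>: on \<open>[0, 1]\<close> its ratio is at most \<open>(1/2) / (q + 1/2)\<close>.\<close>

lemma simple_fraction_polynomial_approx:
  fixes q :: real
  assumes q: "0 < q"
  obtains p where "degree p \<le> n"
    "\<And>x. x \<in> {0..1} \<Longrightarrow> \<bar>x / (q + x) - poly p x\<bar> \<le> (1 / (2 * q + 1)) ^ n / q"
proof
  define l where "l = [: 1 / 2 / (q + 1/2), - 1 / (q + 1/2) :]"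
  define p where "p = (\<Sum>k<n. smult (1 / (q + 1/2)) ([:0, 1:] * l ^ k))"
  show "degree p \<le> n" unfolding p_def
  proof (rule degree_sum_le)
    fix k assume "k \<in> {..<n}"
    then have "Suc k \<le> n" by simp
    have "degree l \<le> 1" by (simp add: l_def)
    then have "degree (l ^ k) \<le> k"
      using degree_power_le[of l k] mult_le_mono1[of "degree l" 1 k] by linarith
    then have "degree ([:0, 1:] * l ^ k) \<le> Suc k"
      using degree_mult_le[of "[:0, 1:]" "l ^ k"] by simp
    then show "degree (smult (1 / (q + 1/2)) ([:0, 1:] * l ^ k)) \<le> n"
      using \<open>Suc k \<le> n\<close> degree_smult_le[of "1 / (q + 1/2)" "[:0, 1:] * l ^ k"] by linarith
  qed simp
  fix x :: real assume x: "x \<in> {0..1}"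
  define z where "z = (1/2 - x) / (q + 1/2)"
  have "poly l x = z" using q by (simp add: l_def z_def diff_divide_distrib)
  then have "poly p x = x / (q + 1/2) * (\<Sum>k<n. z ^ k)"
    by (simp add: p_def poly_sum poly_power sum_distrib_left)
  then have "x / (q + x) - poly p x = x / (q + x) * z ^ n"
    using fraction_minus_geometric_sum[of q "1/2" x n] q x by (simp add: z_def)
  then have "\<bar>x / (q + x) - poly p x\<bar> = x / (q + x) * \<bar>z\<bar> ^ n"
    using q x by (simp add: abs_mult power_abs)
  also have "\<dots> \<le> 1 / q * (1 / (2 * q + 1)) ^ n"
  proof (intro mult_mono power_mono)
    show "x / (q + x) \<le> 1 / q" using q x by (intro frac_le) auto
    have "\<bar>1/2 - x\<bar> \<le> 1/2" using x by (auto simp: abs_if)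
    then have "\<bar>1/2 - x\<bar> / (q + 1/2) \<le> (1/2) / (q + 1/2)" using q by (intro divide_right_mono) auto
    also have "\<dots> = 1 / (2 * q + 1)" using q by (simp add: field_simps)
    finally show "\<bar>z\<bar> \<le> 1 / (2 * q + 1)" using q by (simp add: z_def abs_divide)
  qed (use q x in auto)
  finally show "\<bar>x / (q + x) - poly p x\<bar> \<le> (1 / (2 * q + 1)) ^ n / q" by simp
qed

lemma sum_simple_fractions_polynomial_approx:
  fixes w q :: "'a \<Rightarrow> real"
  assumes q: "\<And>j. j \<in> J \<Longrightarrow> 1 \<le> q j"
  obtains p where "degree p \<le> n"
    "\<And>x. x \<in> {0..1} \<Longrightarrow> \<bar>(\<Sum>j\<in>J. w j * (x / (q j + x))) - poly p x\<bar> \<le> (1/3) ^ n * (\<Sum>j\<in>J. \<bar>w j\<bar> / q j)"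
proof -
  have "\<exists>p. degree p \<le> n \<and> (\<forall>x\<in>{0..1}. \<bar>x / (q j + x) - poly p x\<bar> \<le> (1/3) ^ n / q j)" if j: "j \<in> J" for j
  proof -
    have "(1 / (2 * q j + 1)) ^ n / q j \<le> (1/3) ^ n / q j"
      using q[OF j] by (intro divide_right_mono power_mono frac_le) auto
    moreover obtain p where "degree p \<le> n"
        "\<And>x. x \<in> {0..1} \<Longrightarrow> \<bar>x / (q j + x) - poly p x\<bar> \<le> (1 / (2 * q j + 1)) ^ n / q j"
      using q[OF j] simple_fraction_polynomial_approx[of "q j" n] by auto
    ultimately show ?thesis by (blast intro: order_trans)
  qed
  then obtain p where p: "\<And>j. j \<in> J \<Longrightarrow> degree (p j) \<le> n"
      "\<And>j x. j \<in> J \<Longrightarrow> x \<in> {0..1} \<Longrightarrow> \<bar>x / (q j + x) - poly (p j) x\<bar> \<le> (1/3) ^ n / q j"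
    by metis
  show thesis
  proof
    show "degree (\<Sum>j\<in>J. smult (w j) (p j)) \<le> n"
      using p(1) by (cases "finite J") (auto intro!: degree_sum_le order_trans[OF degree_smult_le])
    fix x :: real assume x: "x \<in> {0..1}"
    have "\<bar>(\<Sum>j\<in>J. w j * (x / (q j + x))) - poly (\<Sum>j\<in>J. smult (w j) (p j)) x\<bar>
        = \<bar>\<Sum>j\<in>J. w j * (x / (q j + x) - poly (p j) x)\<bar>"
      by (simp add: poly_sum right_diff_distrib sum_subtractf)
    also have "\<dots> \<le> (\<Sum>j\<in>J. \<bar>w j\<bar> * \<bar>x / (q j + x) - poly (p j) x\<bar>)"
      by (rule order_trans[OF sum_abs]) (simp add: abs_mult)
    also have "\<dots> \<le> (\<Sum>j\<in>J. \<bar>w j\<bar> * ((1/3) ^ n / q j))"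
      by (intro sum_mono mult_left_mono p(2) x) auto
    also have "\<dots> = (1/3) ^ n * (\<Sum>j\<in>J. \<bar>w j\<bar> / q j)"
      by (simp add: sum_distrib_left mult_ac)
    finally show "\<bar>(\<Sum>j\<in>J. w j * (x / (q j + x))) - poly (\<Sum>j\<in>J. smult (w j) (p j)) x\<bar>
        \<le> (1/3) ^ n * (\<Sum>j\<in>J. \<bar>w j\<bar> / q j)" .
  qed
qed

section \<open>The rational approximation\<close>

lemma rat_approx_eq_simple_fractions:
  fixes N :: nat and w :: "nat \<Rightarrow> real"
  defines "q \<equiv> quadrature_shift (2 * pi\<^sup>2) (pi * sqrt (2 * real N))"
  assumes x: "0 \<le> x"
  shows "rat_approx (\<lambda>j. - (w j * q j)) ([:\<Sum>j=1..N. w j:] + p) N x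
    = (\<Sum>j=1..N. w j * (x / (q j + x))) + poly p x"
proof -
  have "w j * (x / (q j + x)) = - (w j * q j) / (x - pole N j) + w j" for j
  proof -
    have "0 < q j + x" using x unfolding q_def quadrature_shift_def by (intro add_pos_nonneg) auto
    then show ?thesis
      unfolding pole_eq_quadrature_shift q_def [symmetric] by (simp add: field_simps)
  qed
  then show ?thesis unfolding rat_approx_def by (simp only: sum.distrib) simp
qed

lemma trapezoidal_sum_rational_approx:
  fixes N n d :: nat
  defines "h \<equiv> 2 * pi\<^sup>2" and "T \<equiv> pi * sqrt (2 * real N)"
  assumes Nn: "N \<le> n"
  obtains a b where "degree b \<le> d"
    "\<And>x. x \<in> {0..1} \<Longrightarrow> \<bar>rat_approx a b N x - trapezoidal_sum h n T x\<bar> \<le> (1/3) ^ d * exp T"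
proof -
  let ?w = "quadrature_weight h T" and ?q = "quadrature_shift h T"
  have h: "0 < h" by (simp add: h_def)
  have w: "0 \<le> ?w j" and q: "0 < ?q j" for j
    using h by (simp_all add: quadrature_weight_nonneg quadrature_shift_def)
  have "1 \<le> ?q j" if "j \<in> {N<..n}" for j
    unfolding h_def T_def using that by (intro one_le_quadrature_shift) auto
  then obtain p where p: "degree p \<le> d"
      "\<And>x. x \<in> {0..1} \<Longrightarrow> \<bar>(\<Sum>j\<in>{N<..n}. ?w j * (x / (?q j + x))) - poly p x\<bar>
         \<le> (1/3) ^ d * (\<Sum>j\<in>{N<..n}. \<bar>?w j\<bar> / ?q j)"
    using sum_simple_fractions_polynomial_approx[of "{N<..n}" ?q d ?w] by blast
  show thesis
  proof
    show "degree ([:\<Sum>j=1..N. ?w j:] + p) \<le> d"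
      using p(1) by (intro degree_add_le) auto
    fix x :: real assume x: "x \<in> {0..1}"
    have "rat_approx (\<lambda>j. - (?w j * ?q j)) ([:\<Sum>j=1..N. ?w j:] + p) N x
        = (\<Sum>j=1..N. ?w j * (x / (?q j + x))) + poly p x"
      unfolding h_def T_def using x by (intro rat_approx_eq_simple_fractions) simp
    moreover have "trapezoidal_sum h n T x
        = (\<Sum>j=1..N. ?w j * (x / (?q j + x))) + (\<Sum>j\<in>{N<..n}. ?w j * (x / (?q j + x)))"
    proof -
      have "{1..n} = {1..N} \<union> {N<..n}" using Nn by auto
      then show ?thesis
        unfolding trapezoidal_sum_eq_simple_fractions by (simp only:) (subst sum.union_disjoint; auto)
    qed
    ultimately have "\<bar>rat_approx (\<lambda>j. - (?w j * ?q j)) ([:\<Sum>j=1..N. ?w j:] + p) N x - trapezoidal_sum h n T x\<bar>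
        \<le> (1/3) ^ d * (\<Sum>j\<in>{N<..n}. \<bar>?w j\<bar> / ?q j)"
      using p(2)[OF x] by (simp add: abs_minus_commute)
    also have "(\<Sum>j\<in>{N<..n}. \<bar>?w j\<bar> / ?q j) \<le> (\<Sum>j=1..n. ?w j / ?q j)"
      using w q by (simp only: abs_of_nonneg) (intro sum_mono2, auto intro!: divide_nonneg_pos)
    also have "\<dots> \<le> exp T" by (rule sum_quadrature_weight_over_shift_le[OF h])
    finally show "\<bar>rat_approx (\<lambda>j. - (?w j * ?q j)) ([:\<Sum>j=1..N. ?w j:] + p) N x - trapezoidal_sum h n T x\<bar>
        \<le> (1/3) ^ d * exp T" by simp
  qed
qed

definition contour_bound :: "real \<Rightarrow> bool" where
  "contour_bound T \<longleftrightarrow> (\<forall>x \<in> {exp (4 - 2 * T)..1}.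
     cmod (contour_integral (Gamma_path T x) (\<lambda>u. f_int T u x * delta_fn (2 * pi\<^sup>2) u)) < 12 * exp (- T))"

lemma contour_bound_imp_trapezoidal_error_le:
  assumes bound: "contour_bound T" and T: "4 * T\<^sup>2 = real n * (2 * pi\<^sup>2)" and x: "x \<in> {0..1}"
  shows "\<bar>trapezoidal_sum (2 * pi\<^sup>2) n T x - sqrt x\<bar> \<le> (24 + exp 4) * exp (- T)"
proof (cases "x \<le> exp (4 - 2 * T)")
  case True
  then have "\<bar>trapezoidal_sum (2 * pi\<^sup>2) n T x - sqrt x\<bar> \<le> exp 4 * exp (- T)"
    using x by (intro trapezoidal_error_near_zero) auto
  also have "\<dots> \<le> (24 + exp 4) * exp (- T)" by simp
  finally show ?thesis .
next
  case False
  then have x': "x \<in> {exp (4 - 2 * T)..1}" using x by simp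
  then have "\<bar>trapezoidal_sum (2 * pi\<^sup>2) n T x - sqrt x\<bar> \<le> cmod (contour_integral (Gamma_path T x)
      (\<lambda>u. f_int T u x * delta_fn (2 * pi\<^sup>2) u)) + 12 * exp (- T)"
    using T by (intro trapezoidal_error_le_contour_integral) auto
  also have "\<dots> \<le> 12 * exp (- T) + 12 * exp (- T)"
    using bound x' by (intro add_right_mono) (auto simp: contour_bound_def intro: less_imp_le)
  also have "\<dots> \<le> (24 + exp 4) * exp (- T)" by simp
  finally show ?thesis .
qed

lemma power_one_third_le_exp_minus: "(1/3 :: real) ^ d \<le> exp (- real d)"
proof -
  have "(1/3 :: real) ^ d \<le> exp (- 1) ^ d"
    using exp_le by (intro power_mono) (auto simp: exp_minus field_simps)
  then show ?thesis by (simp flip: exp_of_nat_mult)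
qed

lemma sqrt_rational_approx:
  fixes N d :: nat
  defines "T \<equiv> pi * sqrt (2 * real N)"
  assumes bound: "contour_bound T" and d: "2 * T \<le> real d"
  obtains a b where "degree b \<le> d"
    "\<And>x. x \<in> {0..1} \<Longrightarrow> \<bar>rat_approx a b N x - sqrt x\<bar> \<le> (25 + exp 4) * exp (- T)"
proof -
  have "N \<le> 4 * N" by simp
  then obtain a b where b: "degree b \<le> d" and ab: "\<And>x. x \<in> {0..1} \<Longrightarrow>
      \<bar>rat_approx a b N x - trapezoidal_sum (2 * pi\<^sup>2) (4 * N) T x\<bar> \<le> (1/3) ^ d * exp T"
    unfolding T_def using trapezoidal_sum_rational_approx by blast
  have T: "4 * T\<^sup>2 = real (4 * N) * (2 * pi\<^sup>2)"
    by (simp add: T_def power_mult_distrib)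
  have "exp (- real d) \<le> exp (- (2 * T))" using d by simp
  with power_one_third_le_exp_minus[of d] have "(1/3) ^ d \<le> exp (- (2 * T))" by (rule order_trans)
  then have "(1/3) ^ d * exp T \<le> exp (- (2 * T)) * exp T" by (rule mult_right_mono) simp
  also have "\<dots> = exp (- T)" by (simp flip: exp_add)
  finally have tail: "(1/3) ^ d * exp T \<le> exp (- T)" .
  show thesis
  proof (rule that[OF b])
    fix x :: real assume x: "x \<in> {0..1}"
    have "(25 + exp 4) * exp (- T) = exp (- T) + (24 + exp 4) * exp (- T)"
      by (simp add: algebra_simps)
    then show "\<bar>rat_approx a b N x - sqrt x\<bar> \<le> (25 + exp 4) * exp (- T)"
      using ab[OF x] tail contour_bound_imp_trapezoidal_error_le[OF bound T x] by linarith
  qed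
qed

lemma exp_minus_pi_sqrt_le:
  assumes k: "0 \<le> k" and N2: "real N2 \<le> k * sqrt (2 * real N)"
  shows "exp (- (pi * sqrt (2 * real N))) \<le> exp (pi * k) * exp (- pi * sqrt (2 * real (N + N2)))"
proof -
  have "sqrt (2 * real (N + N2)) \<le> sqrt (2 * real N) + k"
  proof (rule real_le_lsqrt)
    have "2 * real (N + N2) \<le> 2 * real N + 2 * (k * sqrt (2 * real N))" using N2 by simp
    also have "\<dots> \<le> (sqrt (2 * real N) + k)\<^sup>2" by (simp add: power2_sum)
    finally show "2 * real (N + N2) \<le> (sqrt (2 * real N) + k)\<^sup>2" .
  qed (use k in auto)
  then have "pi * sqrt (2 * real (N + N2)) \<le> pi * (sqrt (2 * real N) + k)"
    by (intro mult_left_mono) auto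
  then show ?thesis by (simp add: distrib_left flip: exp_add)
qed

lemma nat_ceiling_two_pi_sqrt_le:
  assumes "0 < N"
  shows "real (nat \<lceil>2 * (pi * sqrt (2 * real N))\<rceil>) \<le> (2 * pi + 1) * sqrt (2 * real N)"
proof -
  have "1 \<le> sqrt (2 * real N)" using assms by simp
  moreover have "0 \<le> pi * sqrt (2 * real N)" by simp
  then have "real (nat \<lceil>2 * (pi * sqrt (2 * real N))\<rceil>) \<le> 2 * (pi * sqrt (2 * real N)) + 1"
    by linarith
  ultimately show ?thesis unfolding distrib_right by linarith
qed

lemma sqrt_rational_approx_rate:
  fixes N :: nat
  defines "d \<equiv> nat \<lceil>2 * (pi * sqrt (2 * real N))\<rceil>"
  assumes bound: "contour_bound (pi * sqrt (2 * real N))" and N: "0 < N"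
  shows "\<exists>a b. degree b \<le> d \<and> (\<forall>x\<in>{0..1}. \<bar>rat_approx a b N x - sqrt x\<bar>
     \<le> (25 + exp 4) * exp (pi * (2 * pi + 1)) * exp (- pi * sqrt (2 * real (N + d))))"
proof -
  have "2 * (pi * sqrt (2 * real N)) \<le> real d"
    unfolding d_def by (rule real_nat_ceiling_ge)
  then obtain a b where b: "degree b \<le> d" and ab: "\<And>x. x \<in> {0..1} \<Longrightarrow>
      \<bar>rat_approx a b N x - sqrt x\<bar> \<le> (25 + exp 4) * exp (- (pi * sqrt (2 * real N)))"
    using sqrt_rational_approx bound by blast
  have "exp (- (pi * sqrt (2 * real N))) \<le> exp (pi * (2 * pi + 1)) * exp (- pi * sqrt (2 * real (N + d)))"
    unfolding d_def using nat_ceiling_two_pi_sqrt_le[OF N] by (rule exp_minus_pi_sqrt_le[rotated]) simp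
  then have rate: "(25 + exp 4) * exp (- (pi * sqrt (2 * real N)))
      \<le> (25 + exp 4) * (exp (pi * (2 * pi + 1)) * exp (- pi * sqrt (2 * real (N + d))))"
    by (rule mult_left_mono) (simp add: add_nonneg_nonneg)
  have "\<bar>rat_approx a b N x - sqrt x\<bar>
      \<le> (25 + exp 4) * exp (pi * (2 * pi + 1)) * exp (- pi * sqrt (2 * real (N + d)))" if "x \<in> {0..1}" for x
    unfolding mult.assoc using ab[OF that] rate by (rule order_trans)
  with b show ?thesis by blast
qed

theorem theorem2p3:
  assumes hyp: "\<exists>N0::nat. \<forall>Nt::nat. Nt \<ge> N0 \<and> Nt > 0 \<longrightarrow>
     (let h = 2 * pi^2; T = sqrt (real Nt * h / 4) in
        \<forall>x \<in> {exp (4 - 2*T)..1}.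
          cmod (contour_integral (Gamma_path T x) (\<lambda>u. f_int T u x * delta_fn h u))
            < 12 * exp (- T))"
  shows "\<exists>(a :: nat \<Rightarrow> nat \<Rightarrow> real) (b :: nat \<Rightarrow> real poly) (N2 :: nat \<Rightarrow> nat) C M0.
           \<forall>N1::nat. N1 \<ge> M0 \<and> N1 > 0 \<longrightarrow>
             degree (b N1) \<le> N2 N1 \<and> real (N2 N1) \<le> C * sqrt (real N1) \<and>
             (\<forall>x \<in> {0..1::real}.
                \<bar>rat_approx (a N1) (b N1) N1 x - sqrt x\<bar>
                  \<le> C * exp (- pi * sqrt (2 * real (N1 + N2 N1))))"
proof -
  define N2 where "N2 N = nat \<lceil>2 * (pi * sqrt (2 * real N))\<rceil>" for N :: nat
  define A where "A = (25 + exp 4) * exp (pi * (2 * pi + 1))"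
  define C where "C = (2 * pi + 1) * sqrt 2 + A"
  obtain N0 where N0: "contour_bound (sqrt (real Nt * (2 * pi\<^sup>2) / 4))" if "Nt \<ge> N0" "Nt > 0" for Nt
    using hyp unfolding contour_bound_def Let_def by blast
  have "\<exists>a b. degree b \<le> N2 N \<and> (\<forall>x\<in>{0..1}. \<bar>rat_approx a b N x - sqrt x\<bar>
      \<le> A * exp (- pi * sqrt (2 * real (N + N2 N))))" if N: "N \<ge> N0" "N > 0" for N
  proof -
    have "sqrt (real (4 * N) * (2 * pi\<^sup>2) / 4) = pi * sqrt (2 * real N)"
      by (simp add: real_sqrt_mult mult_ac)
    then have "contour_bound (pi * sqrt (2 * real N))" using N0[of "4 * N"] N by simp
    from sqrt_rational_approx_rate[OF this N(2)] show ?thesis unfolding N2_def A_def .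
  qed
  then obtain a b where ab: "degree (b N) \<le> N2 N" "\<forall>x\<in>{0..1}. \<bar>rat_approx (a N) (b N) N x - sqrt x\<bar>
      \<le> A * exp (- pi * sqrt (2 * real (N + N2 N)))" if "N \<ge> N0" "N > 0" for N
    by metis
  have "real (N2 N) \<le> C * sqrt (real N)" if "N > 0" for N
    using nat_ceiling_two_pi_sqrt_le[OF that]
    by (simp add: N2_def C_def A_def real_sqrt_mult distrib_right add_increasing2)
  moreover have "A * exp t \<le> C * exp t" for t
    by (simp add: C_def)
  ultimately show ?thesis
    using ab by (intro exI[of _ a] exI[of _ b] exI[of _ N2] exI[of _ C] exI[of _ N0]) (blast intro: order_trans)
qed

end
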